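(* Let $V\subset K^n=R^{2n}$ be open and definable and let $f:V\to K$ be definable and $K$-differentiable. Then $\mathrm{Re}\,f$ and $\mathrm{Im}\,f$, regarded as functions on the open subset $V$ of $R^{2n}$, belong to $C^\omega_{\mathcal M}(V)$.
   Context: $\mathcal M$ is an o-minimal structure expanding a real closed field $R$; "definable" means definable in $\mathcal M$ with parameters from $R$. $K=R[\sqrt{-1}]$ is identified with $R^2$ via $x+iy\leftrightarrow(x,y)$, $K^n$ with $R^{2n}$ (topology from $|x+iy|=\sqrt{x^2+y^2}$), and $R^m$ is viewed as $(R\times\{0\})^m\subset K^m$. For open definable $W\subset K^m$, a definable $F:W\to K$ is $K$-differentiable if it is continuous and for each $j$ and $z\in W$ the limit $\lim_{h\to0,\,h\in K\setminus\{0\}}(F(z+he_j)-F(z))/h$ exists in $K$. For open $U\subset R^m$, a definable $f:U\to R$ is $R$-analytic if for every $a\in U$ there are an open neighbourhood $U_a$ of $a$ in $U$, an open $V_a\subset K^m$ with $U_a\subset V_a$ and a definable $K$-differentiable $F:V_a\to K$ with $F|_{U_a}=f|_{U_a}$. $C^\omega_{\mathcal M}(U)$ is the set of definable $R$-analytic functions $U\to R$. *)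

theory Defs
  imports Complex_Main "HOL-Computational_Algebra.Polynomial"
begin

section \<open>Real closed fields\<close>

class real_closed_field = linordered_field +
  assumes nonneg_is_square: "0 \<le> x \<Longrightarrow> \<exists>y. y * y = x"
    and odd_degree_has_root: "odd n \<Longrightarrow> c n \<noteq> 0 \<Longrightarrow> \<exists>x. (\<Sum>k\<le>n. c k * x ^ k) = 0"

instance real :: real_closed_field
proof
  fix x :: real
  assume "0 \<le> x"
  then show "\<exists>y. y * y = x"
    by (intro exI[of _ "sqrt x"]) simp
next
  fix n :: nat and c :: "nat \<Rightarrow> real"
  assume n: "odd n" and c: "c n \<noteq> 0"
  have large: "\<exists>b. \<forall>x\<ge>b. poly p x > 0" if "lead_coeff p > 0" for p :: "real poly"
    using poly_pinfty_gt_lc[OF that] that by (meson less_le_trans)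
  have root: "\<exists>x. poly p x = 0" if odd: "odd (degree p)" and pos: "lead_coeff p > 0"
    for p :: "real poly"
  proof -
    obtain b where b: "\<forall>x\<ge>b. poly p x > 0"
      using large[OF pos] by blast
    define q where "q = - (p \<circ>\<^sub>p [:0, -1:])"
    have "lead_coeff (p \<circ>\<^sub>p [:0, -1:]) = - lead_coeff p"
      using odd by (subst lead_coeff_comp) auto
    then have "lead_coeff q = lead_coeff p"
      by (simp add: q_def)
    then obtain b' where b': "\<forall>x\<ge>b'. poly q x > 0"
      using large[of q] pos by auto
    define d where "d = max 1 (max b b')"
    have "poly p d > 0" "poly p (- d) < 0" "- d < d"
      using b b' by (auto simp: d_def q_def poly_pcompose dest!: spec[of _ d])
    then show ?thesis
      using poly_IVT_pos[of "- d" d p] by blast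
  qed
  define p where "p = (\<Sum>k\<le>n. monom (c k) k)"
  have poly_p: "poly p x = (\<Sum>k\<le>n. c k * x ^ k)" for x
    by (simp add: p_def poly_sum poly_monom)
  have coeff_p: "coeff p k = (if k \<le> n then c k else 0)" for k
    by (simp add: p_def coeff_sum)
  have deg: "degree p = n"
    by (rule antisym) (auto simp: coeff_p c intro!: degree_le le_degree)
  have "\<exists>x. poly p x = 0"
  proof (cases "c n > 0")
    case True
    then show ?thesis using root[of p] n deg by (simp add: coeff_p)
  next
    case False
    then have "\<exists>x. poly (- p) x = 0"
      using root[of "- p"] n deg c by (simp add: coeff_p)
    then show ?thesis by simp
  qed
  then show "\<exists>x. (\<Sum>k\<le>n. c k * x ^ k) = 0"
    by (simp add: poly_p)
qed

definition rsqrt :: "'a::real_closed_field \<Rightarrow> 'a" where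
  "rsqrt x = (THE y. 0 \<le> y \<and> y * y = x)"

lemma rsqrt_ex1:
  fixes x :: "'a::real_closed_field"
  assumes "0 \<le> x"
  shows "\<exists>!y. 0 \<le> y \<and> y * y = x"
proof -
  obtain y where y: "y * y = x"
    using nonneg_is_square[OF assms] by blast
  show ?thesis
  proof
    show "0 \<le> \<bar>y\<bar> \<and> \<bar>y\<bar> * \<bar>y\<bar> = x"
      using y by simp
    show "\<And>z. 0 \<le> z \<and> z * z = x \<Longrightarrow> z = \<bar>y\<bar>"
      using y by (metis abs_of_nonneg abs_eq_iff square_eq_iff)
  qed
qed

lemma rsqrt_nonneg: "0 \<le> x \<Longrightarrow> 0 \<le> rsqrt x"
  and rsqrt_square: "0 \<le> x \<Longrightarrow> rsqrt x * rsqrt x = x"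
  using theI'[OF rsqrt_ex1[of x]] by (auto simp: rsqrt_def)


section \<open>The field $K = R[\sqrt{-1}]$\<close>

datatype 'a cpx = Cpx (re: 'a) (im: 'a)

lemma cpx_eq_iff: "z = w \<longleftrightarrow> re z = re w \<and> im z = im w"
  by (cases z; cases w) simp

lemma sum_squares_pos:
  fixes x y :: "'a::linordered_field"
  shows "x \<noteq> 0 \<or> y \<noteq> 0 \<Longrightarrow> x * x + y * y > 0"
  by (simp add: sum_squares_gt_zero_iff)

instantiation cpx :: (linordered_field) field
begin

definition "0 = Cpx 0 0"
definition "1 = Cpx 1 0"
definition "z + w = Cpx (re z + re w) (im z + im w)"
definition "- z = Cpx (- re z) (- im z)" for z :: "'a cpx"
definition "z - w = Cpx (re z - re w) (im z - im w)"
definition "z * w = Cpx (re z * re w - im z * im w) (re z * im w + im z * re w)"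
definition "inverse z = Cpx (re z / (re z * re z + im z * im z)) (- im z / (re z * re z + im z * im z))"
definition "divide z w = z * inverse w" for z w :: "'a cpx"

instance
proof
  fix z :: "'a cpx"
  assume "z \<noteq> 0"
  then have "re z * re z + im z * im z \<noteq> 0"
    using sum_squares_pos[of "re z" "im z"] by (auto simp: cpx_eq_iff zero_cpx_def)
  then show "inverse z * z = 1"
    by (simp add: cpx_eq_iff inverse_cpx_def times_cpx_def one_cpx_def
        flip: add_divide_distrib diff_divide_distrib)
qed (simp_all add: cpx_eq_iff zero_cpx_def one_cpx_def plus_cpx_def uminus_cpx_def minus_cpx_def
    times_cpx_def inverse_cpx_def divide_cpx_def algebra_simps)

end

definition kabs :: "'a::real_closed_field cpx \<Rightarrow> 'a" where
  "kabs z = rsqrt (re z * re z + im z * im z)"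

definition of_R :: "'a::zero \<Rightarrow> 'a cpx" where
  "of_R x = Cpx x 0"

text \<open>Points of \<open>R\<^sup>m\<close> and \<open>K\<^sup>m\<close> are lists of length \<open>m\<close>. The identification of \<open>K\<^sup>n\<close> with \<open>R\<^sup>2\<^sup>n\<close> sends
  \<open>(x\<^sub>1 + iy\<^sub>1, \<dots>, x\<^sub>n + iy\<^sub>n)\<close> to \<open>(x\<^sub>1, y\<^sub>1, \<dots>, x\<^sub>n, y\<^sub>n)\<close>.\<close>

fun to_reals :: "'a cpx list \<Rightarrow> 'a list" where
  "to_reals [] = []"
| "to_reals (z # zs) = re z # im z # to_reals zs"

fun of_reals :: "'a list \<Rightarrow> 'a cpx list" where
  "of_reals (x # y # xs) = Cpx x y # of_reals xs"
| "of_reals _ = []"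

lemma of_reals_to_reals [simp]: "of_reals (to_reals zs) = zs"
  by (induction zs) auto

lemma length_to_reals [simp]: "length (to_reals zs) = 2 * length zs"
  by (induction zs) auto

lemma to_reals_of_reals: "even (length xs) \<Longrightarrow> to_reals (of_reals xs) = xs"
  by (induction xs rule: of_reals.induct) auto


section \<open>First-order structures expanding an ordered field\<close>

text \<open>The symbols of the ordered ring language are built in and always receive their standard meaning
  (so that the structure expands the field), while \<open>'f\<close> and \<open>'p\<close> are the types of additional function and
  relation symbols. A symbol applied to a list of \<open>k\<close> terms acts as a \<open>k\<close>-ary symbol.\<close>

record ('f, 'p, 'a) expansion =
  fun_interp :: "'f \<Rightarrow> 'a list \<Rightarrow> 'a"
  rel_interp :: "'p \<Rightarrow> 'a list \<Rightarrow> bool"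

datatype 'f fo_term =
    Var nat
  | Zero
  | One
  | Uminus "'f fo_term"
  | Plus "'f fo_term" "'f fo_term"
  | Times "'f fo_term" "'f fo_term"
  | Fun 'f "'f fo_term list"

datatype ('f, 'p) fo_formula =
    Eq "'f fo_term" "'f fo_term"
  | Less "'f fo_term" "'f fo_term"
  | Rel 'p "'f fo_term list"
  | Neg "('f, 'p) fo_formula"
  | Conj "('f, 'p) fo_formula" "('f, 'p) fo_formula"
  | Exists nat "('f, 'p) fo_formula"

primrec term_val ::
  "('f, 'p, 'a::linordered_field) expansion \<Rightarrow> (nat \<Rightarrow> 'a) \<Rightarrow> 'f fo_term \<Rightarrow> 'a" where
  "term_val M e (Var i) = e i"
| "term_val M e Zero = 0"
| "term_val M e One = 1"
| "term_val M e (Uminus t) = - term_val M e t"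
| "term_val M e (Plus s t) = term_val M e s + term_val M e t"
| "term_val M e (Times s t) = term_val M e s * term_val M e t"
| "term_val M e (Fun f ts) = fun_interp M f (map (term_val M e) ts)"

primrec sat ::
  "('f, 'p, 'a::linordered_field) expansion \<Rightarrow> (nat \<Rightarrow> 'a) \<Rightarrow> ('f, 'p) fo_formula \<Rightarrow> bool" where
  "sat M e (Eq s t) \<longleftrightarrow> term_val M e s = term_val M e t"
| "sat M e (Less s t) \<longleftrightarrow> term_val M e s < term_val M e t"
| "sat M e (Rel p ts) \<longleftrightarrow> rel_interp M p (map (term_val M e) ts)"
| "sat M e (Neg A) \<longleftrightarrow> \<not> sat M e A"
| "sat M e (Conj A B) \<longleftrightarrow> sat M e A \<and> sat M e B"
| "sat M e (Exists i A) \<longleftrightarrow> (\<exists>a. sat M (e(i := a)) A)"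

text \<open>The variables below \<open>n\<close> hold the point, the remaining ones hold the parameters; only finitely
  many of them occur in a formula.\<close>

definition definable ::
  "('f, 'p, 'a::linordered_field) expansion \<Rightarrow> nat \<Rightarrow> 'a list set \<Rightarrow> bool" where
  "definable M n S \<longleftrightarrow> (\<exists>A c. S = {xs. length xs = n \<and> sat M (\<lambda>i. if i < n then xs ! i else c i) A})"

definition o_minimal :: "('f, 'p, 'a::linordered_field) expansion \<Rightarrow> bool" where
  "o_minimal M \<longleftrightarrow> (\<forall>S. definable M 1 S \<longrightarrow>
     (\<exists>\<I>. finite \<I> \<and> {x. [x] \<in> S} = \<Union>\<I> \<and>
        (\<forall>I\<in>\<I>. (\<exists>a. I = {a}) \<or> (\<exists>a b. I = {a<..<b}) \<or> (\<exists>a. I = {a<..}) \<or> (\<exists>b. I = {..<b}) \<or> I = UNIV)))"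

definition definable_fun ::
  "('f, 'p, 'a::linordered_field) expansion \<Rightarrow> nat \<Rightarrow> 'a list set \<Rightarrow> ('a list \<Rightarrow> 'a) \<Rightarrow> bool" where
  "definable_fun M m U f \<longleftrightarrow> definable M (m + 1) ((\<lambda>x. x @ [f x]) ` U)"

definition K_definable ::
  "('f, 'p, 'a::linordered_field) expansion \<Rightarrow> nat \<Rightarrow> 'a cpx list set \<Rightarrow> bool" where
  "K_definable M m W \<longleftrightarrow> definable M (2 * m) (to_reals ` W)"

definition K_definable_fun ::
  "('f, 'p, 'a::linordered_field) expansion \<Rightarrow> nat \<Rightarrow> 'a cpx list set \<Rightarrow> ('a cpx list \<Rightarrow> 'a cpx) \<Rightarrow> bool" where
  "K_definable_fun M m W F \<longleftrightarrow> K_definable M (m + 1) ((\<lambda>z. z @ [F z]) ` W)"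


section \<open>Topology, \<open>K\<close>-differentiability and \<open>R\<close>-analyticity\<close>

definition R_open :: "nat \<Rightarrow> 'a::linordered_field list set \<Rightarrow> bool" where
  "R_open m U \<longleftrightarrow> U \<subseteq> {x. length x = m} \<and>
     (\<forall>x\<in>U. \<exists>\<epsilon>>0. \<forall>y. length y = m \<and> (\<forall>j<m. \<bar>y ! j - x ! j\<bar> < \<epsilon>) \<longrightarrow> y \<in> U)"

definition K_open :: "nat \<Rightarrow> 'a::real_closed_field cpx list set \<Rightarrow> bool" where
  "K_open m W \<longleftrightarrow> W \<subseteq> {z. length z = m} \<and>
     (\<forall>z\<in>W. \<exists>\<epsilon>>0. \<forall>w. length w = m \<and> (\<forall>j<m. kabs (w ! j - z ! j) < \<epsilon>) \<longrightarrow> w \<in> W)"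

definition K_continuous_on ::
  "nat \<Rightarrow> 'a::real_closed_field cpx list set \<Rightarrow> ('a cpx list \<Rightarrow> 'a cpx) \<Rightarrow> bool" where
  "K_continuous_on m W F \<longleftrightarrow>
     (\<forall>z\<in>W. \<forall>\<epsilon>>0. \<exists>\<delta>>0. \<forall>w\<in>W. (\<forall>j<m. kabs (w ! j - z ! j) < \<delta>) \<longrightarrow> kabs (F w - F z) < \<epsilon>)"

definition has_K_partial ::
  "'a::real_closed_field cpx list set \<Rightarrow> ('a cpx list \<Rightarrow> 'a cpx) \<Rightarrow> nat \<Rightarrow> 'a cpx list \<Rightarrow> 'a cpx \<Rightarrow> bool" where
  "has_K_partial W F j z L \<longleftrightarrow>
     (\<forall>\<epsilon>>0. \<exists>\<delta>>0. \<forall>h. h \<noteq> 0 \<and> kabs h < \<delta> \<and> z[j := z ! j + h] \<in> W \<longrightarrow>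
        kabs ((F (z[j := z ! j + h]) - F z) / h - L) < \<epsilon>)"

definition K_differentiable_on ::
  "nat \<Rightarrow> 'a::real_closed_field cpx list set \<Rightarrow> ('a cpx list \<Rightarrow> 'a cpx) \<Rightarrow> bool" where
  "K_differentiable_on m W F \<longleftrightarrow>
     K_continuous_on m W F \<and> (\<forall>j<m. \<forall>z\<in>W. \<exists>L. has_K_partial W F j z L)"

definition R_analytic_on ::
  "('f, 'p, 'a::real_closed_field) expansion \<Rightarrow> nat \<Rightarrow> 'a list set \<Rightarrow> ('a list \<Rightarrow> 'a) \<Rightarrow> bool" where
  "R_analytic_on M m U f \<longleftrightarrow>
     (\<forall>a\<in>U. \<exists>Ua Va F.
        R_open m Ua \<and> a \<in> Ua \<and> Ua \<subseteq> U \<and>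
        K_open m Va \<and> K_definable M m Va \<and> map of_R ` Ua \<subseteq> Va \<and>
        K_definable_fun M m Va F \<and> K_differentiable_on m Va F \<and>
        (\<forall>x\<in>Ua. F (map of_R x) = of_R (f x)))"

definition C_omega ::
  "('f, 'p, 'a::real_closed_field) expansion \<Rightarrow> nat \<Rightarrow> 'a list set \<Rightarrow> ('a list \<Rightarrow> 'a) set" where
  "C_omega M m U = {f. R_open m U \<and> definable_fun M m U f \<and> R_analytic_on M m U f}"

end

theory Submission
  imports Defs
begin

text \<open>For real \<open>x, y\<close> one has \<open>2 Re f(x + iy) = f(x + iy) + f\<^sup>*(x - iy)\<close>, where \<open>f\<^sup>*(w)\<close> is the conjugate of \<open>f\<close>
  at the conjugate of \<open>w\<close> and is again \<open>K\<close>-differentiable. The right-hand side makes sense for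
  \<open>x, y \<in> K\<^sup>n\<close>, is definable, and is \<open>K\<close>-differentiable because moving one coordinate of \<open>(x, y)\<close> moves
  only one coordinate of \<open>x + iy\<close> and of \<open>x - iy\<close>. The imaginary part is the real part of \<open>-i f\<close>.\<close>

section \<open>Closure properties of definable sets\<close>

text \<open>The extension is given by one explicit formula on one domain, so the same pair serves
  every base point. Two obstacles shape the rest. First, \<open>K\<close>-differentiability only
  speaks of single coordinates, and a general \<open>K\<close>-linear substitution would call for
  joint differentiability of \<open>f\<close>. The sparsity of \<open>pair_K\<close> avoids this:
  each difference quotient of the composite is, up to a factor 1 or \<open>i_K\<close>, a difference
  quotient of \<open>f\<close> in one coordinate. Second, definability is defined through formulas
  and parameter sequences, so it has to be obtained by syntax. Everything is reduced to two
  operations: pulling two definable sets back along tuples of terms and intersecting, and projecting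
  away the last coordinate. Terms have no division, so the equation for the graph of the extension
  is solved for a value of \<open>f\<close>, which turns the factor 1/2 into doublings.\<close>

primrec term_vars :: "'f fo_term \<Rightarrow> nat set" where
  "term_vars (Var i) = {i}"
| "term_vars Zero = {}"
| "term_vars One = {}"
| "term_vars (Uminus t) = term_vars t"
| "term_vars (Plus s t) = term_vars s \<union> term_vars t"
| "term_vars (Times s t) = term_vars s \<union> term_vars t"
| "term_vars (Fun f ts) = \<Union> (set (map term_vars ts))"

primrec term_subst :: "(nat \<Rightarrow> 'f fo_term) \<Rightarrow> 'f fo_term \<Rightarrow> 'f fo_term" where
  "term_subst \<sigma> (Var i) = \<sigma> i"
| "term_subst \<sigma> Zero = Zero"
| "term_subst \<sigma> One = One"
| "term_subst \<sigma> (Uminus t) = Uminus (term_subst \<sigma> t)"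
| "term_subst \<sigma> (Plus s t) = Plus (term_subst \<sigma> s) (term_subst \<sigma> t)"
| "term_subst \<sigma> (Times s t) = Times (term_subst \<sigma> s) (term_subst \<sigma> t)"
| "term_subst \<sigma> (Fun f ts) = Fun f (map (term_subst \<sigma>) ts)"

text \<open>Capture is avoided by renaming the variable bound at depth \<open>d\<close> to \<open>b d\<close>.\<close>

primrec formula_subst ::
  "(nat \<Rightarrow> nat) \<Rightarrow> ('f, 'p) fo_formula \<Rightarrow> nat \<Rightarrow> (nat \<Rightarrow> 'f fo_term) \<Rightarrow> ('f, 'p) fo_formula" where
  "formula_subst b (Eq s t) d \<sigma> = Eq (term_subst \<sigma> s) (term_subst \<sigma> t)"
| "formula_subst b (Less s t) d \<sigma> = Less (term_subst \<sigma> s) (term_subst \<sigma> t)"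
| "formula_subst b (Rel p ts) d \<sigma> = Rel p (map (term_subst \<sigma>) ts)"
| "formula_subst b (Neg A) d \<sigma> = Neg (formula_subst b A d \<sigma>)"
| "formula_subst b (Conj A B) d \<sigma> = Conj (formula_subst b A d \<sigma>) (formula_subst b B d \<sigma>)"
| "formula_subst b (Exists i A) d \<sigma> = Exists (b d) (formula_subst b A (Suc d) (\<sigma>(i := Var (b d))))"

lemma term_val_cong:
  "(\<And>i. i \<in> term_vars t \<Longrightarrow> e i = e' i) \<Longrightarrow> term_val M e t = term_val M e' t"
proof (induction t)
  case (Fun f ts)
  then have "map (term_val M e) ts = map (term_val M e') ts"
    by (intro map_cong) auto
  then show ?case by (simp del: map_eq_conv)
qed auto

lemma term_val_subst:
  "term_val M e (term_subst \<sigma> t) = term_val M (\<lambda>i. term_val M e (\<sigma> i)) t"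
proof (induction t)
  case (Fun f ts)
  then have "map (term_val M e) (map (term_subst \<sigma>) ts) = map (term_val M (\<lambda>i. term_val M e (\<sigma> i))) ts"
    by simp
  then show ?case by (simp del: map_eq_conv map_map)
qed auto

lemma sat_formula_subst:
  assumes "inj b" and "\<And>i. term_vars (\<sigma> i) \<inter> b ` {d..} = {}"
  shows "sat M e (formula_subst b A d \<sigma>) \<longleftrightarrow> sat M (\<lambda>i. term_val M e (\<sigma> i)) A"
  using assms(2)
proof (induction A arbitrary: d \<sigma> e)
  case (Rel p ts)
  have "map (term_val M e) (map (term_subst \<sigma>) ts) = map (term_val M (\<lambda>i. term_val M e (\<sigma> i))) ts"
    by (simp add: term_val_subst)
  then show ?case by (simp del: map_eq_conv map_map)
next
  case (Exists i A)
  have fresh: "term_vars ((\<sigma>(i := Var (b d))) j) \<inter> b ` {Suc d..} = {}" for j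
  proof -
    have "b ` {Suc d..} \<subseteq> b ` {d..}" by auto
    then show ?thesis
      using Exists.prems[of j] \<open>inj b\<close> by (auto dest: injD)
  qed
  have "(\<lambda>j. term_val M (e(b d := a)) ((\<sigma>(i := Var (b d))) j)) = (\<lambda>j. term_val M e (\<sigma> j))(i := a)" for a
  proof
    fix j
    have "b d \<notin> term_vars (\<sigma> j)" using Exists.prems[of j] by auto
    then have "term_val M (e(b d := a)) (\<sigma> j) = term_val M e (\<sigma> j)"
      by (intro term_val_cong) auto
    then show "term_val M (e(b d := a)) ((\<sigma>(i := Var (b d))) j) = ((\<lambda>j. term_val M e (\<sigma> j))(i := a)) j"
      by simp
  qed
  then show ?case
    by (simp add: Exists.IH[OF fresh] del: fun_upd_apply)
qed (simp_all add: term_val_subst)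

section \<open>Closure under preimages along terms, intersections and projections\<close>

text \<open>Both preimages are taken at once because the two formulas come with separate parameter
  sequences, which have to be merged into one before they can be conjoined. Using terms instead of
  variables covers linear changes of coordinates.\<close>

lemma definable_preimage_Int:
  assumes "definable M n S" and "definable M k T"
    and "length ts = n" and "length us = k"
    and vars: "\<And>t. t \<in> set ts \<union> set us \<Longrightarrow> term_vars t \<subseteq> {..<m}"
  shows "definable M m {xs. length xs = m \<and> map (term_val M ((!) xs)) ts \<in> S
           \<and> map (term_val M ((!) xs)) us \<in> T}"
proof -
  obtain A c where A: "S = {xs. length xs = n \<and> sat M (\<lambda>i. if i < n then xs ! i else c i) A}"
    using assms(1) by (auto simp: definable_def)
  obtain B d where B: "T = {xs. length xs = k \<and> sat M (\<lambda>i. if i < k then xs ! i else d i) B}"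
    using assms(2) by (auto simp: definable_def)
  \<comment> \<open>Beyond the \<open>m\<close> coordinates, the residues modulo 3 separate the parameters of \<open>A\<close>, those of \<open>B\<close>,
    and the bound variables.\<close>
  define b where "b j = m + 3 * j + 2" for j
  define \<sigma> where "\<sigma> i = (if i < n then ts ! i else Var (m + 3 * i))" for i
  define \<tau> where "\<tau> i = (if i < k then us ! i else Var (m + 3 * i + 1))" for i
  \<comment> \<open>Residue 2 lands in the \<open>d\<close> branch only as a default: after the
    substitution those variables occur bound.\<close>
  define p where "p i = (if (i - m) mod 3 = 0 then c ((i - m) div 3) else d ((i - m) div 3))" for i
  define E where "E xs i = (if i < m then xs ! i else p i)" for xs i
  have inj: "inj b" by (auto simp: inj_def b_def)
  have b: "j \<notin> b ` {0..}" if "j < m" for j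
    using that by (auto simp: b_def)
  have "term_vars (\<sigma> i) \<inter> b ` {0..} = {}" for i
  proof (cases "i < n")
    case True
    then have "term_vars (\<sigma> i) \<subseteq> {..<m}" using vars assms(3) by (auto simp: \<sigma>_def)
    then show ?thesis using b by blast
  next
    case False
    then show ?thesis by (auto simp: \<sigma>_def b_def) presburger
  qed
  note sA = sat_formula_subst[OF inj this]
  have "term_vars (\<tau> i) \<inter> b ` {0..} = {}" for i
  proof (cases "i < k")
    case True
    then have "term_vars (\<tau> i) \<subseteq> {..<m}" using vars assms(4) by (auto simp: \<tau>_def)
    then show ?thesis using b by blast
  next
    case False
    then show ?thesis by (auto simp: \<tau>_def b_def) presburger
  qed
  note sB = sat_formula_subst[OF inj this]
  have val: "term_val M (E xs) t = term_val M ((!) xs) t" if "t \<in> set ts \<union> set us" for xs t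
    using vars[OF that] by (intro term_val_cong) (auto simp: E_def)
  have "p (m + 3 * i) = c i" "p (Suc (m + 3 * i)) = d i" for i
  proof -
    have "Suc (3 * i) div 3 = i" by presburger
    then show "p (m + 3 * i) = c i" "p (Suc (m + 3 * i)) = d i"
      by (simp_all add: p_def)
  qed
  then have "(\<lambda>i. term_val M (E xs) (\<sigma> i)) = (\<lambda>i. if i < n then map (term_val M ((!) xs)) ts ! i else c i)"
    and "(\<lambda>i. term_val M (E xs) (\<tau> i)) = (\<lambda>i. if i < k then map (term_val M ((!) xs)) us ! i else d i)" for xs
    using assms(3,4) by (auto simp: fun_eq_iff \<sigma>_def \<tau>_def val) (auto simp: E_def)
  then have "{xs. length xs = m \<and> map (term_val M ((!) xs)) ts \<in> S \<and> map (term_val M ((!) xs)) us \<in> T}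
    = {xs. length xs = m \<and> sat M (E xs) (Conj (formula_subst b A 0 \<sigma>) (formula_subst b B 0 \<tau>))}"
    by (auto simp: A B sA sB assms(3,4))
  then show ?thesis
    unfolding definable_def E_def by blast
qed

lemma definable_preimage:
  assumes "definable M n S" and "length ts = n"
    and "\<And>t. t \<in> set ts \<Longrightarrow> term_vars t \<subseteq> {..<m}"
  shows "definable M m {xs. length xs = m \<and> map (term_val M ((!) xs)) ts \<in> S}"
  using definable_preimage_Int[of M n S n S ts ts m] assms by simp

text \<open>The same formula can be quantified over variable \<open>n\<close> without renaming: the
  assignments for \<open>n\<close> and for \<open>Suc n\<close> coordinates differ only at
  \<open>n\<close>, where \<open>Exists n\<close> overwrites the parameter \<open>c n\<close> by the
  missing last coordinate.\<close>

lemma definable_project: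
  assumes "definable M (Suc n) S"
  shows "definable M n {xs. length xs = n \<and> (\<exists>a. xs @ [a] \<in> S)}"
proof -
  obtain A c where A: "S = {xs. length xs = Suc n \<and> sat M (\<lambda>i. if i < Suc n then xs ! i else c i) A}"
    using assms by (auto simp: definable_def)
  have "(\<lambda>i. if i < Suc n then (xs @ [a]) ! i else c i) = (\<lambda>i. if i < n then xs ! i else c i)(n := a)"
    if "length xs = n" for xs a
    using that by (auto simp: fun_eq_iff nth_append)
  then have "{xs. length xs = n \<and> (\<exists>a. xs @ [a] \<in> S)}
    = {xs. length xs = n \<and> sat M (\<lambda>i. if i < n then xs ! i else c i) (Exists n A)}"
    by (auto simp: A)
  then show ?thesis
    unfolding definable_def by blast
qed

section \<open>Absolute value and conjugation on \<open>K\<close>\<close>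

definition cnj_K :: "'a::linordered_field cpx \<Rightarrow> 'a cpx" where
  "cnj_K z = Cpx (re z) (- im z)"

definition i_K :: "'a::linordered_field cpx" where
  "i_K = Cpx 0 1"

lemmas cpx_defs = cpx_eq_iff zero_cpx_def one_cpx_def plus_cpx_def uminus_cpx_def minus_cpx_def
  times_cpx_def inverse_cpx_def divide_cpx_def

lemma kabs_nonneg [simp]: "0 \<le> kabs z"
  by (simp add: kabs_def rsqrt_nonneg)

lemma kabs_sq: "kabs z * kabs z = re z * re z + im z * im z"
  by (simp add: kabs_def rsqrt_square)

lemma kabs_unique: "0 \<le> x \<Longrightarrow> x * x = re z * re z + im z * im z \<Longrightarrow> kabs z = x"
  by (metis kabs_nonneg kabs_sq abs_of_nonneg abs_eq_iff square_eq_iff)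

lemma kabs_mult: "kabs (z * w) = kabs z * kabs w"
proof (rule kabs_unique)
  have "kabs z * kabs w * (kabs z * kabs w) = (kabs z * kabs z) * (kabs w * kabs w)"
    by (simp add: algebra_simps)
  then show "kabs z * kabs w * (kabs z * kabs w)
    = re (z * w) * re (z * w) + im (z * w) * im (z * w)"
    by (simp add: kabs_sq cpx_defs algebra_simps)
qed simp

text \<open>Cauchy-Schwarz comes from the two-square identity for the product of the squared
  absolute values, which is purely algebraic and hence valid over every real closed field.\<close>

lemma kabs_triangle: "kabs (z + w) \<le> kabs z + kabs w"
proof -
  have "re z * re w + im z * im w \<le> kabs z * kabs w"
  proof (rule power2_le_imp_le)
    have "(kabs z * kabs w)\<^sup>2 = (kabs z * kabs z) * (kabs w * kabs w)"
      by (simp add: power2_eq_square algebra_simps)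
    also have "\<dots> = (re z * re w + im z * im w)\<^sup>2 + (re z * im w - im z * re w)\<^sup>2"
      by (simp add: kabs_sq power2_eq_square algebra_simps)
    finally show "(re z * re w + im z * im w)\<^sup>2 \<le> (kabs z * kabs w)\<^sup>2" by simp
  qed simp
  then have "(kabs (z + w))\<^sup>2 \<le> (kabs z + kabs w)\<^sup>2"
    using kabs_sq[of z] kabs_sq[of w] kabs_sq[of "z + w"]
    by (simp add: power2_eq_square cpx_defs algebra_simps)
  then show ?thesis by (rule power2_le_imp_le) simp
qed

lemma kabs_cnj [simp]: "kabs (cnj_K z) = kabs z"
  by (simp add: kabs_def cnj_K_def)

lemma kabs_i [simp]: "kabs i_K = 1"
  by (rule kabs_unique) (simp_all add: i_K_def)

lemma kabs_one [simp]: "kabs 1 = 1"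
  by (rule kabs_unique) (simp_all add: one_cpx_def)

lemma i_K_neq_0 [simp]: "i_K \<noteq> 0"
  by (simp add: i_K_def cpx_defs)

lemma kabs_le_sum: "kabs z \<le> \<bar>re z\<bar> + \<bar>im z\<bar>"
proof (rule power2_le_imp_le)
  have "(kabs z)\<^sup>2 = \<bar>re z\<bar> * \<bar>re z\<bar> + \<bar>im z\<bar> * \<bar>im z\<bar>"
    using kabs_sq[of z] by (simp add: power2_eq_square)
  also have "\<dots> \<le> (\<bar>re z\<bar> + \<bar>im z\<bar>)\<^sup>2"
    by (simp add: power2_eq_square algebra_simps)
  finally show "(kabs z)\<^sup>2 \<le> (\<bar>re z\<bar> + \<bar>im z\<bar>)\<^sup>2" .
qed simp

lemma cnj_K_cnj [simp]: "cnj_K (cnj_K z) = z"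
  and cnj_K_add: "cnj_K (z + w) = cnj_K z + cnj_K w"
  and cnj_K_diff: "cnj_K (z - w) = cnj_K z - cnj_K w"
  and cnj_K_divide: "cnj_K (z / w) = cnj_K z / cnj_K w"
  and cnj_K_eq_0 [simp]: "cnj_K z = 0 \<longleftrightarrow> z = 0"
  by (simp_all add: cnj_K_def cpx_defs)

section \<open>Operations preserving \<open>K\<close>-differentiability\<close>

lemma K_continuous_onD:
  assumes "K_continuous_on m W F" "z \<in> W" "0 < \<epsilon>"
  obtains \<delta> where "0 < \<delta>"
    "\<And>w. w \<in> W \<Longrightarrow> (\<And>j. j < m \<Longrightarrow> kabs (w ! j - z ! j) < \<delta>) \<Longrightarrow> kabs (F w - F z) < \<epsilon>"
  using assms unfolding K_continuous_on_def by meson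

lemma has_K_partialD:
  assumes "has_K_partial W F j z L" "0 < \<epsilon>"
  obtains \<delta> where "0 < \<delta>"
    "\<And>h. h \<noteq> 0 \<Longrightarrow> kabs h < \<delta> \<Longrightarrow> z[j := z ! j + h] \<in> W \<Longrightarrow>
      kabs ((F (z[j := z ! j + h]) - F z) / h - L) < \<epsilon>"
  using assms unfolding has_K_partial_def by meson

text \<open>\<open>has_K_partial\<close> only tests increments that stay in the set, so shrinking
  the set weakens every condition, whether or not it is open.\<close>

lemma K_differentiable_on_subset:
  assumes "K_differentiable_on m W F" "W' \<subseteq> W"
  shows "K_differentiable_on m W' F"
  using assms unfolding K_differentiable_on_def K_continuous_on_def has_K_partial_def
  by (meson subsetD)

lemma K_differentiable_on_cmult:
  assumes "K_differentiable_on m W F"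
  shows "K_differentiable_on m W (\<lambda>z. c * F z)"
proof -
  \<comment> \<open>The summand 1 keeps the denominator positive when \<open>c\<close> is 0.\<close>
  have *: "kabs (c * u) < \<epsilon>" if "kabs u < \<epsilon> / (kabs c + 1)" "0 < \<epsilon>" for u and \<epsilon> :: 'a
  proof -
    have pos: "0 < kabs c + 1" by (simp add: add_nonneg_pos)
    have "kabs (c * u) \<le> (kabs c + 1) * kabs u"
      by (simp add: kabs_mult algebra_simps)
    also have "\<dots> < \<epsilon>"
      using that(1) pos by (simp add: field_simps)
    finally show ?thesis .
  qed
  have pos: "0 < \<epsilon> / (kabs c + 1)" if "0 < \<epsilon>" for \<epsilon> :: 'a
    using that by (intro divide_pos_pos add_nonneg_pos) auto
  have "K_continuous_on m W (\<lambda>z. c * F z)"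
    unfolding K_continuous_on_def
  proof (intro ballI allI impI)
    fix z and \<epsilon> :: 'a
    assume z: "z \<in> W" and \<epsilon>: "0 < \<epsilon>"
    have "K_continuous_on m W F" using assms by (simp add: K_differentiable_on_def)
    from K_continuous_onD[OF this z pos[OF \<epsilon>]] obtain \<delta> where \<delta>: "0 < \<delta>"
      "\<And>w. w \<in> W \<Longrightarrow> (\<And>j. j < m \<Longrightarrow> kabs (w ! j - z ! j) < \<delta>) \<Longrightarrow> kabs (F w - F z) < \<epsilon> / (kabs c + 1)"
      by blast
    then show "\<exists>\<delta>>0. \<forall>w\<in>W. (\<forall>j<m. kabs (w ! j - z ! j) < \<delta>) \<longrightarrow> kabs (c * F w - c * F z) < \<epsilon>"
      using * \<epsilon> by (metis right_diff_distrib)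
  qed
  moreover have "has_K_partial W (\<lambda>z. c * F z) j z (c * L)" if L: "has_K_partial W F j z L" for j z L
    unfolding has_K_partial_def
  proof (intro allI impI)
    fix \<epsilon> :: 'a
    assume \<epsilon>: "0 < \<epsilon>"
    from has_K_partialD[OF L pos[OF \<epsilon>]] obtain \<delta> where \<delta>: "0 < \<delta>"
      "\<And>h. h \<noteq> 0 \<Longrightarrow> kabs h < \<delta> \<Longrightarrow> z[j := z ! j + h] \<in> W \<Longrightarrow>
        kabs ((F (z[j := z ! j + h]) - F z) / h - L) < \<epsilon> / (kabs c + 1)"
      by blast
    have eq: "(c * u - c * v) / h - c * L = c * ((u - v) / h - L)" for u v h
      by (simp add: right_diff_distrib)
    show "\<exists>\<delta>>0. \<forall>h. h \<noteq> 0 \<and> kabs h < \<delta> \<and> z[j := z ! j + h] \<in> W \<longrightarrow>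
        kabs ((c * F (z[j := z ! j + h]) - c * F z) / h - c * L) < \<epsilon>"
      unfolding eq using \<delta> * \<epsilon> by blast
  qed
  ultimately show ?thesis
    using assms unfolding K_differentiable_on_def by blast
qed

lemma K_differentiable_on_add:
  assumes "K_differentiable_on m W F" "K_differentiable_on m W G"
  shows "K_differentiable_on m W (\<lambda>z. F z + G z)"
proof -
  have *: "kabs (u + v) < \<epsilon>" if "kabs u < \<epsilon> / 2" "kabs v < \<epsilon> / 2" for u v :: "'a cpx" and \<epsilon>
    using kabs_triangle[of u v] add_strict_mono[OF that] by (simp flip: add_divide_distrib)
  have "K_continuous_on m W (\<lambda>z. F z + G z)"
    unfolding K_continuous_on_def
  proof (intro ballI allI impI)
    fix z and \<epsilon> :: 'a
    assume z: "z \<in> W" and "0 < \<epsilon>"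
    then have \<epsilon>: "0 < \<epsilon> / 2" by simp
    have "K_continuous_on m W F" "K_continuous_on m W G"
      using assms by (simp_all add: K_differentiable_on_def)
    from K_continuous_onD[OF this(1) z \<epsilon>] K_continuous_onD[OF this(2) z \<epsilon>] obtain \<delta> \<delta>' where
      \<delta>: "0 < \<delta>"
        "\<And>w. w \<in> W \<Longrightarrow> (\<And>j. j < m \<Longrightarrow> kabs (w ! j - z ! j) < \<delta>) \<Longrightarrow> kabs (F w - F z) < \<epsilon> / 2"
      and \<delta>': "0 < \<delta>'"
        "\<And>w. w \<in> W \<Longrightarrow> (\<And>j. j < m \<Longrightarrow> kabs (w ! j - z ! j) < \<delta>') \<Longrightarrow> kabs (G w - G z) < \<epsilon> / 2"
      by metis
    have "kabs (F w + G w - (F z + G z)) < \<epsilon>"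
      if "w \<in> W" "\<forall>j<m. kabs (w ! j - z ! j) < min \<delta> \<delta>'" for w
      using *[of "F w - F z" \<epsilon> "G w - G z"] \<delta>(2)[of w] \<delta>'(2)[of w] that by (simp add: algebra_simps)
    then show "\<exists>\<delta>>0. \<forall>w\<in>W. (\<forall>j<m. kabs (w ! j - z ! j) < \<delta>) \<longrightarrow> kabs (F w + G w - (F z + G z)) < \<epsilon>"
      using \<delta>(1) \<delta>'(1) by (intro exI[of _ "min \<delta> \<delta>'"]) auto
  qed
  moreover have "has_K_partial W (\<lambda>z. F z + G z) j z (L + L')"
    if L: "has_K_partial W F j z L" "has_K_partial W G j z L'" for j z L L'
    unfolding has_K_partial_def
  proof (intro allI impI)
    fix \<epsilon> :: 'a
    assume "0 < \<epsilon>"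
    then have \<epsilon>: "0 < \<epsilon> / 2" by simp
    from has_K_partialD[OF L(1) \<epsilon>] has_K_partialD[OF L(2) \<epsilon>] obtain \<delta> \<delta>' where \<delta>: "0 < \<delta>"
      "\<And>h. h \<noteq> 0 \<Longrightarrow> kabs h < \<delta> \<Longrightarrow> z[j := z ! j + h] \<in> W \<Longrightarrow>
        kabs ((F (z[j := z ! j + h]) - F z) / h - L) < \<epsilon> / 2"
      and \<delta>': "0 < \<delta>'"
      "\<And>h. h \<noteq> 0 \<Longrightarrow> kabs h < \<delta>' \<Longrightarrow> z[j := z ! j + h] \<in> W \<Longrightarrow>
        kabs ((G (z[j := z ! j + h]) - G z) / h - L') < \<epsilon> / 2"
      by metis
    have eq: "(u + u' - (v + v')) / h - (L + L') = ((u - v) / h - L) + ((u' - v') / h - L')" for u v u' v' h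
      by (simp add: diff_divide_distrib add_divide_distrib)
    show "\<exists>\<delta>>0. \<forall>h. h \<noteq> 0 \<and> kabs h < \<delta> \<and> z[j := z ! j + h] \<in> W \<longrightarrow>
        kabs ((F (z[j := z ! j + h]) + G (z[j := z ! j + h]) - (F z + G z)) / h - (L + L')) < \<epsilon>"
      unfolding eq using \<delta> \<delta>' * by (intro exI[of _ "min \<delta> \<delta>'"]) auto
  qed
  ultimately show ?thesis
    using assms unfolding K_differentiable_on_def by blast
qed

lemma K_open_Int:
  assumes "K_open m W" "K_open m W'"
  shows "K_open m (W \<inter> W')"
  unfolding K_open_def
proof (intro conjI ballI)
  fix z
  assume "z \<in> W \<inter> W'"
  then obtain \<epsilon> \<epsilon>' where \<epsilon>: "\<epsilon> > 0" "\<forall>w. length w = m \<and> (\<forall>j<m. kabs (w ! j - z ! j) < \<epsilon>) \<longrightarrow> w \<in> W"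
    "\<epsilon>' > 0" "\<forall>w. length w = m \<and> (\<forall>j<m. kabs (w ! j - z ! j) < \<epsilon>') \<longrightarrow> w \<in> W'"
    using assms unfolding K_open_def by blast
  then show "\<exists>\<epsilon>>0. \<forall>w. length w = m \<and> (\<forall>j<m. kabs (w ! j - z ! j) < \<epsilon>) \<longrightarrow> w \<in> W \<inter> W'"
    by (intro exI[of _ "min \<epsilon> \<epsilon>'"]) auto
qed (use assms in \<open>auto simp: K_open_def\<close>)

lemma kabs_cnj_diff: "kabs (cnj_K z - cnj_K w) = kabs (z - w)"
  by (simp flip: cnj_K_diff)

lemma K_open_cnj:
  assumes "K_open m W"
  shows "K_open m {z. map cnj_K z \<in> W}"
proof -
  have len: "length z = m" if "map cnj_K z \<in> W" for z
    using assms that by (auto simp: K_open_def)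
  show ?thesis
    unfolding K_open_def
  proof (intro conjI ballI)
    fix z assume z: "z \<in> {z. map cnj_K z \<in> W}"
    then obtain \<epsilon> where \<epsilon>: "\<epsilon> > 0"
      "\<And>w. length w = m \<Longrightarrow> (\<forall>j<m. kabs (w ! j - map cnj_K z ! j) < \<epsilon>) \<Longrightarrow> w \<in> W"
      using assms unfolding K_open_def by blast
    then show "\<exists>\<epsilon>>0. \<forall>w. length w = m \<and> (\<forall>j<m. kabs (w ! j - z ! j) < \<epsilon>) \<longrightarrow> w \<in> {z. map cnj_K z \<in> W}"
      using z len by (intro exI[of _ \<epsilon>]) (auto simp: kabs_cnj_diff)
  qed (use len in auto)
qed

text \<open>The two conjugations cancel in the difference quotient: with increment \<open>h\<close>
  it is the conjugate of the quotient of \<open>F\<close> with increment \<open>cnj_K h\<close>. As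
  conjugation preserves \<open>kabs\<close>, the same \<open>\<delta>\<close> works and the
  derivative is \<open>cnj_K L\<close>.\<close>

lemma K_differentiable_on_cnj:
  assumes len: "W \<subseteq> {z. length z = m}" and F: "K_differentiable_on m W F"
  shows "K_differentiable_on m {z. map cnj_K z \<in> W} (\<lambda>z. cnj_K (F (map cnj_K z)))"
    (is "K_differentiable_on m ?W ?F")
proof -
  have lenz: "length z = m" if "map cnj_K z \<in> W" for z
    using len that by auto
  have "K_continuous_on m ?W ?F"
    unfolding K_continuous_on_def
  proof (intro ballI allI impI)
    fix z and \<epsilon> :: 'a
    assume z: "z \<in> ?W" and \<epsilon>: "0 < \<epsilon>"
    then have z': "map cnj_K z \<in> W" by simp
    have "K_continuous_on m W F" using F by (simp add: K_differentiable_on_def)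
    from K_continuous_onD[OF this z' \<epsilon>] obtain \<delta> where \<delta>: "0 < \<delta>"
      "\<And>w. w \<in> W \<Longrightarrow> (\<And>j. j < m \<Longrightarrow> kabs (w ! j - map cnj_K z ! j) < \<delta>) \<Longrightarrow>
        kabs (F w - F (map cnj_K z)) < \<epsilon>"
      by blast
    show "\<exists>\<delta>>0. \<forall>w\<in>?W. (\<forall>j<m. kabs (w ! j - z ! j) < \<delta>) \<longrightarrow> kabs (?F w - ?F z) < \<epsilon>"
      using \<delta> lenz z' by (intro exI[of _ \<delta>]) (auto simp: kabs_cnj_diff)
  qed
  moreover have "has_K_partial ?W ?F j z (cnj_K L)"
    if j: "j < m" and z: "z \<in> ?W" and L: "has_K_partial W F j (map cnj_K z) L" for j z L
    unfolding has_K_partial_def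
  proof (intro allI impI)
    fix \<epsilon> :: 'a
    assume \<epsilon>: "0 < \<epsilon>"
    from has_K_partialD[OF L \<epsilon>] obtain \<delta> where \<delta>: "0 < \<delta>"
      "\<And>h. h \<noteq> 0 \<Longrightarrow> kabs h < \<delta> \<Longrightarrow> (map cnj_K z)[j := map cnj_K z ! j + h] \<in> W \<Longrightarrow>
        kabs ((F ((map cnj_K z)[j := map cnj_K z ! j + h]) - F (map cnj_K z)) / h - L) < \<epsilon>"
      by blast
    have upd: "map cnj_K (z[j := z ! j + h]) = (map cnj_K z)[j := map cnj_K z ! j + cnj_K h]" for h
      using j z lenz by (simp add: map_update cnj_K_add)
    have "kabs ((?F (z[j := z ! j + h]) - ?F z) / h - cnj_K L) < \<epsilon>"
      if "h \<noteq> 0" "kabs h < \<delta>" "z[j := z ! j + h] \<in> ?W" for h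
    proof -
      have "(?F (z[j := z ! j + h]) - ?F z) / h - cnj_K L
          = cnj_K ((F (map cnj_K (z[j := z ! j + h])) - F (map cnj_K z)) / cnj_K h - L)"
        by (simp add: cnj_K_diff cnj_K_divide)
      then have "kabs ((?F (z[j := z ! j + h]) - ?F z) / h - cnj_K L)
          = kabs ((F (map cnj_K (z[j := z ! j + h])) - F (map cnj_K z)) / cnj_K h - L)"
        by simp
      then show ?thesis using \<delta>(2)[of "cnj_K h"] that by (simp only: upd mem_Collect_eq) simp
    qed
    then show "\<exists>\<delta>>0. \<forall>h. h \<noteq> 0 \<and> kabs h < \<delta> \<and> z[j := z ! j + h] \<in> ?W \<longrightarrow>
        kabs ((?F (z[j := z ! j + h]) - ?F z) / h - cnj_K L) < \<epsilon>"
      using \<delta>(1) by blast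
  qed
  ultimately show ?thesis
    using F unfolding K_differentiable_on_def by blast
qed

section \<open>The complexified identification of \<open>R\<^sup>2\<^sup>n\<close> with \<open>K\<^sup>n\<close>\<close>

text \<open>The \<open>K\<close>-linear map \<open>(X\<^sub>1, Y\<^sub>1, \<dots>, X\<^sub>n, Y\<^sub>n) \<mapsto> (X\<^sub>1 + iY\<^sub>1, \<dots>, X\<^sub>n + iY\<^sub>n)\<close> on \<open>K\<^sup>2\<^sup>n\<close>, which on real
  points is \<open>of_reals\<close>.\<close>

definition pair_K :: "'a::linordered_field cpx list \<Rightarrow> 'a cpx list" where
  "pair_K z = map (\<lambda>k. z ! (2 * k) + i_K * z ! (2 * k + 1)) [0..<length z div 2]"

lemma length_pair_K [simp]: "length (pair_K z) = length z div 2"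
  by (simp add: pair_K_def)

lemma nth_pair_K: "k < length z div 2 \<Longrightarrow> pair_K z ! k = z ! (2 * k) + i_K * z ! (2 * k + 1)"
  by (simp add: pair_K_def)

lemma nth_to_reals:
  "k < length z \<Longrightarrow> to_reals z ! (2 * k) = re (z ! k) \<and> to_reals z ! Suc (2 * k) = im (z ! k)"
proof (induction z arbitrary: k)
  case (Cons a z)
  then show ?case by (cases k) auto
qed simp

lemma pair_K_of_R: "pair_K (map of_R (to_reals z)) = z"
  by (rule nth_equalityI) (auto simp: nth_pair_K nth_to_reals cpx_defs i_K_def of_R_def)

text \<open>Each coordinate of \<open>pair_K\<close> collects two coordinates with coefficients of
  absolute value 1, hence the radius \<open>\<delta> / 2\<close>.\<close>

lemma kabs_pair_K_diff:
  assumes "k < n" "length z = 2 * n" "length w = 2 * n" "\<forall>j<2 * n. kabs (w ! j - z ! j) < \<delta> / 2"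
  shows "kabs (pair_K w ! k - pair_K z ! k) < \<delta>"
proof -
  have "pair_K w ! k - pair_K z ! k
      = (w ! (2 * k) - z ! (2 * k)) + i_K * (w ! (2 * k + 1) - z ! (2 * k + 1))"
    using assms by (simp add: nth_pair_K algebra_simps)
  then have "kabs (pair_K w ! k - pair_K z ! k)
      \<le> kabs (w ! (2 * k) - z ! (2 * k)) + kabs (w ! (2 * k + 1) - z ! (2 * k + 1))"
    using kabs_triangle[of "w ! (2 * k) - z ! (2 * k)" "i_K * (w ! (2 * k + 1) - z ! (2 * k + 1))"]
    by (simp add: kabs_mult)
  also have "\<dots> < \<delta> / 2 + \<delta> / 2"
    using assms by (intro add_strict_mono) auto
  finally show ?thesis by (simp flip: add_divide_distrib)
qed

lemma pair_K_update:
  assumes "j < 2 * n" "length z = 2 * n"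
  shows "pair_K (z[j := z ! j + h])
    = (pair_K z)[j div 2 := pair_K z ! (j div 2) + (if even j then 1 else i_K) * h]"
proof (rule nth_equalityI)
  fix k
  assume k: "k < length (pair_K (z[j := z ! j + h]))"
  show "pair_K (z[j := z ! j + h]) ! k
    = (pair_K z)[j div 2 := pair_K z ! (j div 2) + (if even j then 1 else i_K) * h] ! k"
  proof (cases "even j")
    case True
    then obtain l where l: "j = 2 * l" by blast
    have "2 * k + 1 \<noteq> j" using l by presburger
    then show ?thesis using k assms l by (auto simp: nth_pair_K nth_list_update algebra_simps)
  next
    case False
    then obtain l where l: "j = 2 * l + 1" by (auto elim: oddE)
    have "2 * k \<noteq> j" using l by presburger
    then show ?thesis using k assms l by (auto simp: nth_pair_K nth_list_update algebra_simps)
  qed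
qed simp

lemma K_open_pair:
  assumes "K_open n V"
  shows "K_open (2 * n) {z. length z = 2 * n \<and> pair_K z \<in> V}"
  unfolding K_open_def
proof (intro conjI ballI)
  fix z
  assume z: "z \<in> {z. length z = 2 * n \<and> pair_K z \<in> V}"
  then obtain \<epsilon> where \<epsilon>: "\<epsilon> > 0"
    "\<And>w. length w = n \<Longrightarrow> (\<forall>j<n. kabs (w ! j - pair_K z ! j) < \<epsilon>) \<Longrightarrow> w \<in> V"
    using assms unfolding K_open_def by blast
  then show "\<exists>\<epsilon>>0. \<forall>w. length w = 2 * n \<and> (\<forall>j<2 * n. kabs (w ! j - z ! j) < \<epsilon>) \<longrightarrow>
      w \<in> {z. length z = 2 * n \<and> pair_K z \<in> V}"
    using z by (intro exI[of _ "\<epsilon> / 2"]) (auto intro!: \<epsilon>(2) kabs_pair_K_diff)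
qed auto

lemma K_differentiable_on_pair:
  assumes f: "K_differentiable_on n V f"
  shows "K_differentiable_on (2 * n) {z. length z = 2 * n \<and> pair_K z \<in> V} (\<lambda>z. f (pair_K z))"
    (is "K_differentiable_on _ ?W ?F")
proof -
  have "K_continuous_on (2 * n) ?W ?F"
    unfolding K_continuous_on_def
  proof (intro ballI allI impI)
    fix z and \<epsilon> :: 'a
    assume z: "z \<in> ?W" and \<epsilon>: "0 < \<epsilon>"
    then have z': "pair_K z \<in> V" by simp
    have "K_continuous_on n V f" using f by (simp add: K_differentiable_on_def)
    from K_continuous_onD[OF this z' \<epsilon>] obtain \<delta> where \<delta>: "0 < \<delta>"
      "\<And>w. w \<in> V \<Longrightarrow> (\<And>j. j < n \<Longrightarrow> kabs (w ! j - pair_K z ! j) < \<delta>) \<Longrightarrow> kabs (f w - f (pair_K z)) < \<epsilon>"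
      by blast
    then show "\<exists>\<delta>>0. \<forall>w\<in>?W. (\<forall>j<2 * n. kabs (w ! j - z ! j) < \<delta>) \<longrightarrow> kabs (?F w - ?F z) < \<epsilon>"
      using z by (intro exI[of _ "\<delta> / 2"]) (auto intro!: \<delta>(2) kabs_pair_K_diff)
  qed
  moreover have "\<exists>L. has_K_partial ?W ?F j z L" if j: "j < 2 * n" and z: "z \<in> ?W" for j z
  proof -
    define c :: "'a cpx" where "c = (if even j then 1 else i_K)"
    have c: "c \<noteq> 0" "kabs c = 1"
      by (auto simp: c_def)
    have "j div 2 < n" using j by simp
    then obtain L where L: "has_K_partial V f (j div 2) (pair_K z) L"
      using f z unfolding K_differentiable_on_def by blast
    have "has_K_partial ?W ?F j z (c * L)"
      unfolding has_K_partial_def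
    proof (intro allI impI)
      fix \<epsilon> :: 'a
      assume \<epsilon>: "0 < \<epsilon>"
      from has_K_partialD[OF L \<epsilon>] obtain \<delta> where \<delta>: "0 < \<delta>"
        "\<And>h. h \<noteq> 0 \<Longrightarrow> kabs h < \<delta> \<Longrightarrow> (pair_K z)[j div 2 := pair_K z ! (j div 2) + h] \<in> V \<Longrightarrow>
          kabs ((f ((pair_K z)[j div 2 := pair_K z ! (j div 2) + h]) - f (pair_K z)) / h - L) < \<epsilon>"
        by blast
      have upd: "pair_K (z[j := z ! j + h]) = (pair_K z)[j div 2 := pair_K z ! (j div 2) + c * h]" for h
        using j z by (simp add: pair_K_update c_def)
      have "kabs ((?F (z[j := z ! j + h]) - ?F z) / h - c * L) < \<epsilon>"
        if "h \<noteq> 0" "kabs h < \<delta>" "z[j := z ! j + h] \<in> ?W" for h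
      proof -
        \<comment> \<open>The increment seen by \<open>f\<close> is \<open>c * h\<close>; since
          \<open>kabs c = 1\<close>, the rescaling costs nothing in either \<open>\<delta>\<close>
          or \<open>\<epsilon>\<close>.\<close>
        have "kabs (u / h - c * L) = kabs (u / (c * h) - L)" for u
        proof -
          have "u / h - c * L = c * (u / (c * h) - L)"
            using c that(1) by (simp add: right_diff_distrib)
          then show ?thesis by (simp only: kabs_mult c mult_1)
        qed
        moreover have "kabs ((?F (z[j := z ! j + h]) - ?F z) / (c * h) - L) < \<epsilon>"
          unfolding upd
        proof (rule \<delta>(2))
          show "c * h \<noteq> 0" "kabs (c * h) < \<delta>"
            using that(1,2) c by (simp_all add: kabs_mult)
          show "(pair_K z)[j div 2 := pair_K z ! (j div 2) + c * h] \<in> V"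
            using that(3) by (simp flip: upd)
        qed
        ultimately show ?thesis by (simp only:)
      qed
      then show "\<exists>\<delta>>0. \<forall>h. h \<noteq> 0 \<and> kabs h < \<delta> \<and> z[j := z ! j + h] \<in> ?W \<longrightarrow>
          kabs ((?F (z[j := z ! j + h]) - ?F z) / h - c * L) < \<epsilon>"
        using \<delta>(1) by blast
    qed
    then show ?thesis by blast
  qed
  ultimately show ?thesis
    unfolding K_differentiable_on_def by blast
qed

section \<open>The complexification of the real part\<close>

text \<open>Terms for the real coordinates of \<open>pair_K z\<close> and \<open>pair_K (map cnj_K z)\<close> in those of \<open>z\<close>: with
  \<open>X = a + ib\<close> and \<open>Y = c + id\<close> these are \<open>(a - d, b + c)\<close> and \<open>(a + d, c - b)\<close>.\<close>

definition pair_terms :: "nat \<Rightarrow> 'f fo_term list" where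
  "pair_terms n = map (\<lambda>i. if even i then Plus (Var (2 * i)) (Uminus (Var (2 * i + 3)))
     else Plus (Var (2 * i - 1)) (Var (2 * i))) [0..<2 * n]"

definition pair_cnj_terms :: "nat \<Rightarrow> 'f fo_term list" where
  "pair_cnj_terms n = map (\<lambda>i. if even i then Plus (Var (2 * i)) (Var (2 * i + 3))
     else Plus (Var (2 * i)) (Uminus (Var (2 * i - 1)))) [0..<2 * n]"

lemma length_pair_terms [simp]:
  "length (pair_terms n) = 2 * n" "length (pair_cnj_terms n) = 2 * n"
  by (simp_all add: pair_terms_def pair_cnj_terms_def)

lemma vars_pair_terms:
  assumes "t \<in> set (pair_terms n) \<union> set (pair_cnj_terms n)" "4 * n \<le> m"
  shows "term_vars t \<subseteq> {..<m}"
proof -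
  obtain i where i: "i < 2 * n" and t: "t = pair_terms n ! i \<or> t = pair_cnj_terms n ! i"
    using assms(1) by (auto simp: in_set_conv_nth)
  have "even i \<Longrightarrow> 2 * i + 3 < m" "2 * i < m"
    using i assms(2) by presburger+
  then show ?thesis
    using i t by (cases "even i") (auto simp: pair_terms_def pair_cnj_terms_def)
qed

text \<open>The arbitrary tail \<open>ys\<close> lets the same terms be evaluated when further
  coordinates follow those of \<open>z\<close>, as happens for graphs and auxiliary
  witnesses.\<close>

lemma term_val_pair_terms:
  assumes z: "length z = 2 * n"
  shows "map (term_val M ((!) (to_reals z @ ys))) (pair_terms n) = to_reals (pair_K z)"
    and "map (term_val M ((!) (to_reals z @ ys))) (pair_cnj_terms n) = to_reals (pair_K (map cnj_K z))"
proof -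
  define x where "x = to_reals z @ ys"
  have x: "x ! (2 * k) = re (z ! k)" "x ! Suc (2 * k) = im (z ! k)" if "k < 2 * n" for k
    using that z nth_to_reals[of k z] by (simp_all add: x_def nth_append)
  \<comment> \<open>The k-th pair occupies four real positions starting at \<open>4 * k\<close>.
    Entry \<open>i = 2 * k\<close> of the term lists therefore reads positions \<open>2 * i\<close>
    and \<open>2 * i + 3\<close>, while entry \<open>i = 2 * k + 1\<close> reads
    \<open>2 * i - 1\<close> and \<open>2 * i\<close>.\<close>
  have c: "x ! (4 * k) = re (z ! (2 * k))" "x ! (4 * k + 1) = im (z ! (2 * k))"
    "x ! (4 * k + 2) = re (z ! (2 * k + 1))" "x ! (4 * k + 3) = im (z ! (2 * k + 1))" if "k < n" for k
    using x[of "2 * k"] x[of "2 * k + 1"] that by (simp_all add: numeral_3_eq_3)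
  have even_odd: thesis
    if "i < 2 * n" "\<And>k. k < n \<Longrightarrow> i = 2 * k \<Longrightarrow> thesis" "\<And>k. k < n \<Longrightarrow> i = Suc (2 * k) \<Longrightarrow> thesis" for i thesis
    using that by (cases "even i") (auto elim!: evenE oddE)
  show "map (term_val M ((!) (to_reals z @ ys))) (pair_terms n) = to_reals (pair_K z)"
    unfolding x_def[symmetric]
  proof (rule nth_equalityI)
    fix i
    assume "i < length (map (term_val M ((!) x)) (pair_terms n))"
    then have "i < 2 * n" by simp
    then show "map (term_val M ((!) x)) (pair_terms n) ! i = to_reals (pair_K z) ! i"
    proof (rule even_odd)
      fix k
      assume k: "k < n" "i = 2 * k"
      then show ?thesis
        using c[of k] z by (simp add: pair_terms_def nth_to_reals nth_pair_K i_K_def cpx_defs)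
    next
      fix k
      assume k: "k < n" "i = Suc (2 * k)"
      then show ?thesis
        using c[of k] z by (simp add: pair_terms_def nth_to_reals nth_pair_K i_K_def cpx_defs)
    qed
  qed (simp add: z)
  show "map (term_val M ((!) (to_reals z @ ys))) (pair_cnj_terms n) = to_reals (pair_K (map cnj_K z))"
    unfolding x_def[symmetric]
  proof (rule nth_equalityI)
    fix i
    assume "i < length (map (term_val M ((!) x)) (pair_cnj_terms n))"
    then have "i < 2 * n" by simp
    then show "map (term_val M ((!) x)) (pair_cnj_terms n) ! i = to_reals (pair_K (map cnj_K z)) ! i"
    proof (rule even_odd)
      fix k
      assume k: "k < n" "i = 2 * k"
      then show ?thesis
        using c[of k] z
        by (simp add: pair_cnj_terms_def nth_to_reals nth_pair_K i_K_def cnj_K_def cpx_defs)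
    next
      fix k
      assume k: "k < n" "i = Suc (2 * k)"
      then show ?thesis
        using c[of k] z
        by (simp add: pair_cnj_terms_def nth_to_reals nth_pair_K i_K_def cnj_K_def cpx_defs)
    qed
  qed (simp add: z)
qed

lemma to_reals_append: "to_reals (z @ w) = to_reals z @ to_reals w"
  by (induction z) auto

lemma to_reals_in_image [simp]: "to_reals z \<in> to_reals ` V \<longleftrightarrow> z \<in> V"
  by (metis image_iff of_reals_to_reals)

lemma to_reals_in_graph:
  "to_reals z @ [a, b] \<in> to_reals ` (\<lambda>z. z @ [f z]) ` V \<longleftrightarrow> z \<in> V \<and> f z = Cpx a b"
proof -
  have "to_reals z @ [a, b] = to_reals (z @ [Cpx a b])" by (simp add: to_reals_append)
  then show ?thesis by (simp only: to_reals_in_image) auto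
qed

text \<open>For \<open>z = (x, y)\<close>, evaluating the conjugated function at x - iy means
  evaluating \<open>f\<close> at the conjugate of x - iy, which is
  \<open>pair_K (map cnj_K z)\<close>. The last condition places this point in
  \<open>V\<close>.\<close>

definition complexify_dom :: "nat \<Rightarrow> 'a::linordered_field cpx list set \<Rightarrow> 'a cpx list set" where
  "complexify_dom n V = {z. length z = 2 * n \<and> pair_K z \<in> V \<and> pair_K (map cnj_K z) \<in> V}"

definition complexify_re ::
  "('a::linordered_field cpx list \<Rightarrow> 'a cpx) \<Rightarrow> 'a cpx list \<Rightarrow> 'a cpx" where
  "complexify_re f z = of_R (1 / 2) * (f (pair_K z) + cnj_K (f (pair_K (map cnj_K z))))"

text \<open>In this form openness and differentiability follow from the lemmas on
  \<open>pair_K\<close>, on conjugation and on intersections.\<close>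

lemma complexify_dom_eq:
  "complexify_dom n V = {z. length z = 2 * n \<and> pair_K z \<in> V}
     \<inter> {z. map cnj_K z \<in> {z. length z = 2 * n \<and> pair_K z \<in> V}}"
  by (auto simp: complexify_dom_def)

lemma K_definable_complexify_dom:
  assumes "K_definable M n V"
  shows "K_definable M (2 * n) (complexify_dom n V)"
proof -
  have "to_reals ` complexify_dom n V = {xs. length xs = 2 * (2 * n)
      \<and> map (term_val M ((!) xs)) (pair_terms n) \<in> to_reals ` V
      \<and> map (term_val M ((!) xs)) (pair_cnj_terms n) \<in> to_reals ` V}" (is "_ = ?B")
  proof -
    have "to_reals z \<in> ?B \<longleftrightarrow> z \<in> complexify_dom n V" for z
    proof (cases "length z = 2 * n")
      case True
      then show ?thesis
        using term_val_pair_terms[of z n M "[]"] by (simp add: complexify_dom_def)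
    qed (simp add: complexify_dom_def)
    moreover have "xs \<in> range to_reals" if "xs \<in> ?B" for xs
      using that to_reals_of_reals[of xs] by (metis (mono_tags, lifting) dvd_triv_left mem_Collect_eq rangeI)
    ultimately show ?thesis by blast
  qed
  moreover have "definable M (2 * (2 * n)) ?B"
    using assms unfolding K_definable_def
    by (intro definable_preimage_Int vars_pair_terms) auto
  ultimately show ?thesis
    by (simp add: K_definable_def)
qed

text \<open>Solving for the second value of \<open>f\<close> removes both the factor 1/2 and the
  conjugation; naming the first value \<open>Cpx a b\<close> leaves two graph conditions whose
  entries are terms.\<close>

lemma complexify_re_eq_iff:
  "complexify_re f z = w \<longleftrightarrow>
     (\<exists>a b. f (pair_K z) = Cpx a b
        \<and> f (pair_K (map cnj_K z)) = Cpx (re w + re w - a) (b - (im w + im w)))"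
proof -
  have half: "1 / 2 * x = y \<longleftrightarrow> x = y + y" for x y :: 'a
    by (auto simp: field_simps)
  have "complexify_re f z = w \<longleftrightarrow> f (pair_K (map cnj_K z))
     = Cpx (re w + re w - re (f (pair_K z))) (im (f (pair_K z)) - (im w + im w))"
    by (auto simp: complexify_re_def cpx_defs of_R_def cnj_K_def half[simplified])
  then show ?thesis
    by (metis cpx.collapse cpx.sel)
qed

lemma K_definable_complexify_re:
  fixes M :: "('f, 'p, 'a::linordered_field) expansion"
  assumes "K_definable_fun M n V f"
  shows "K_definable_fun M (2 * n) (complexify_dom n V) (complexify_re f)"
proof -
  define G where "G = to_reals ` (\<lambda>z. z @ [f z]) ` V"
  define m where "m = 2 * (2 * n + 1)"
  define ts :: "'f fo_term list" where "ts = pair_terms n @ [Var m, Var (Suc m)]"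
  define us :: "'f fo_term list" where "us = pair_cnj_terms n @
    [Plus (Plus (Var (4 * n)) (Var (4 * n))) (Uminus (Var m)),
     Plus (Var (Suc m)) (Uminus (Plus (Var (4 * n + 1)) (Var (4 * n + 1))))]"
  \<comment> \<open>The coordinates are those of \<open>z\<close> (positions below
    \<open>4 * n\<close>), then the candidate value \<open>w\<close> at \<open>4 * n\<close> and
    \<open>4 * n + 1\<close>, then the witnesses \<open>a\<close> and \<open>b\<close> at
    \<open>m\<close> and \<open>Suc m\<close>. Two projections remove the witnesses.\<close>
  define B where "B = {xs. length xs = Suc (Suc m) \<and> map (term_val M ((!) xs)) ts \<in> G
    \<and> map (term_val M ((!) xs)) us \<in> G}"
  have "definable M (2 * (n + 1)) G"
    using assms by (simp add: G_def K_definable_fun_def K_definable_def)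
  moreover have "term_vars t \<subseteq> {..<Suc (Suc m)}" if "t \<in> set ts \<union> set us" for t
    using that vars_pair_terms[of t n "Suc (Suc m)"] by (auto simp: ts_def us_def m_def)
  ultimately have "definable M (Suc (Suc m)) B"
    unfolding B_def by (intro definable_preimage_Int) (auto simp: ts_def us_def)
  then have "definable M m {xs. length xs = m \<and>
      (\<exists>a. xs @ [a] \<in> {xs. length xs = Suc m \<and> (\<exists>b. xs @ [b] \<in> B)})}"
    by (intro definable_project)
  moreover have "{xs. length xs = m \<and> (\<exists>a. xs @ [a] \<in> {xs. length xs = Suc m \<and> (\<exists>b. xs @ [b] \<in> B)})}
    = to_reals ` (\<lambda>z. z @ [complexify_re f z]) ` complexify_dom n V" (is "?P = ?Q")
  proof (rule set_eqI)
    fix xs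
    show "xs \<in> ?P \<longleftrightarrow> xs \<in> ?Q"
    proof (cases "length xs = m")
      case True
      define z where "z = butlast (of_reals xs)"
      define w where "w = last (of_reals xs)"
      have xs: "xs = to_reals (of_reals xs)"
        using True by (simp add: to_reals_of_reals m_def)
      then have len: "length (of_reals xs) = 2 * n + 1"
        using True length_to_reals[of "of_reals xs"] by (simp add: m_def)
      then have "of_reals xs = z @ [w]"
        by (metis z_def w_def append_butlast_last_id Suc_eq_plus1 list.size(3) nat.distinct(1))
      then have xs_eq: "xs = to_reals z @ [re w, im w]" and z: "length z = 2 * n"
        using xs len by (simp_all add: to_reals_append)
      have "xs @ [a, b] \<in> B \<longleftrightarrow> pair_K z \<in> V \<and> f (pair_K z) = Cpx a b \<and> pair_K (map cnj_K z) \<in> V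
          \<and> f (pair_K (map cnj_K z)) = Cpx (re w + re w - a) (b - (im w + im w))" for a b
      proof -
        have nths: "(xs @ [a, b]) ! (4 * n) = re w" "(xs @ [a, b]) ! Suc (4 * n) = im w"
          "(xs @ [a, b]) ! m = a" "(xs @ [a, b]) ! Suc m = b"
          using z True by (auto simp: xs_eq nth_append m_def)
        have app: "xs @ [a, b] = to_reals z @ [re w, im w, a, b]"
          by (simp add: xs_eq)
        have "map (term_val M ((!) (xs @ [a, b]))) ts = to_reals (pair_K z) @ [a, b]"
          using term_val_pair_terms(1)[OF z, of M "[re w, im w, a, b]"] nths
          by (simp add: ts_def app del: append_assoc)
        moreover have "map (term_val M ((!) (xs @ [a, b]))) us
            = to_reals (pair_K (map cnj_K z)) @ [re w + re w - a, b - (im w + im w)]"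
          using term_val_pair_terms(2)[OF z, of M "[re w, im w, a, b]"] nths
          by (simp add: us_def app del: append_assoc)
        ultimately show ?thesis
          using True by (simp add: B_def G_def to_reals_in_graph)
      qed
      then have "xs \<in> ?P \<longleftrightarrow> z \<in> complexify_dom n V \<and> complexify_re f z = w"
        unfolding complexify_re_eq_iff using True z by (auto simp: complexify_dom_def)
      also have "\<dots> \<longleftrightarrow> xs \<in> ?Q"
        unfolding xs_eq to_reals_in_graph by simp
      finally show ?thesis .
    next
      case False
      then show ?thesis by (auto simp: m_def complexify_dom_def)
    qed
  qed
  ultimately show ?thesis
    by (simp add: K_definable_fun_def K_definable_def m_def)
qed

lemma K_differentiable_on_complexify_re:
  assumes "K_differentiable_on n V f"
  shows "K_differentiable_on (2 * n) (complexify_dom n V) (complexify_re f)"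
proof -
  let ?W = "{z. length z = 2 * n \<and> pair_K z \<in> V}"
  have f: "K_differentiable_on (2 * n) ?W (\<lambda>z. f (pair_K z))"
    by (rule K_differentiable_on_pair[OF assms])
  have "K_differentiable_on (2 * n) {z. map cnj_K z \<in> ?W} (\<lambda>z. cnj_K (f (pair_K (map cnj_K z))))"
    by (rule K_differentiable_on_cnj[OF _ f]) auto
  with f have "K_differentiable_on (2 * n) (complexify_dom n V) (\<lambda>z. f (pair_K z))"
    "K_differentiable_on (2 * n) (complexify_dom n V) (\<lambda>z. cnj_K (f (pair_K (map cnj_K z))))"
    by (auto elim!: K_differentiable_on_subset simp: complexify_dom_eq)
  then show ?thesis
    unfolding complexify_re_def[abs_def]
    by (intro K_differentiable_on_cmult K_differentiable_on_add)
qed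

text \<open>Real points are fixed by conjugation, so both arguments of \<open>f\<close> equal
  \<open>z\<close> and the formula averages \<open>f z\<close> with its conjugate.\<close>

lemma complexify_re_of_R:
  "complexify_re f (map of_R (to_reals z)) = of_R (re (f z))"
proof -
  have "map cnj_K (map of_R xs) = map of_R xs" for xs :: "'a list"
    by (simp add: cnj_K_def of_R_def)
  then show ?thesis
    unfolding complexify_re_def by (simp only: pair_K_of_R) (simp add: cnj_K_def of_R_def cpx_defs)
qed

lemma map_of_R_in_complexify_dom:
  assumes "V \<subseteq> {z. length z = n}" "z \<in> V"
  shows "map of_R (to_reals z) \<in> complexify_dom n V"
proof -
  have "map cnj_K (map of_R xs) = map of_R xs" for xs :: "'a list"
    by (simp add: cnj_K_def of_R_def)
  then show ?thesis
    using assms unfolding complexify_dom_def by (simp only: pair_K_of_R mem_Collect_eq) auto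
qed

section \<open>From the extension to membership in \<open>C_omega\<close>\<close>

lemma R_open_to_reals:
  assumes "K_open n V"
  shows "R_open (2 * n) (to_reals ` V)"
  unfolding R_open_def
proof (intro conjI ballI)
  show "to_reals ` V \<subseteq> {x. length x = 2 * n}"
    using assms by (auto simp: K_open_def)
next
  fix x
  assume "x \<in> to_reals ` V"
  then obtain z where z: "z \<in> V" "x = to_reals z" by blast
  have len: "length z = n" using assms z by (auto simp: K_open_def)
  obtain \<epsilon> where \<epsilon>: "\<epsilon> > 0" "\<And>w. length w = n \<Longrightarrow> (\<And>j. j < n \<Longrightarrow> kabs (w ! j - z ! j) < \<epsilon>) \<Longrightarrow> w \<in> V"
    using assms z unfolding K_open_def by meson
  have "y \<in> to_reals ` V" if y: "length y = 2 * n" "\<forall>j<2 * n. \<bar>y ! j - x ! j\<bar> < \<epsilon> / 2" for y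
  proof -
    define w where "w = of_reals y"
    have yw: "y = to_reals w" using y(1) by (simp add: w_def to_reals_of_reals)
    then have lenw: "length w = n" using y(1) by simp
    have "kabs (w ! j - z ! j) < \<epsilon>" if j: "j < n" for j
    proof -
      have "\<bar>y ! (2 * j) - x ! (2 * j)\<bar> < \<epsilon> / 2" "\<bar>y ! Suc (2 * j) - x ! Suc (2 * j)\<bar> < \<epsilon> / 2"
        using y(2) j by auto
      then have "\<bar>re (w ! j - z ! j)\<bar> < \<epsilon> / 2" "\<bar>im (w ! j - z ! j)\<bar> < \<epsilon> / 2"
        using j len lenw by (simp_all add: yw z(2) nth_to_reals minus_cpx_def)
      from add_strict_mono[OF this] have "\<bar>re (w ! j - z ! j)\<bar> + \<bar>im (w ! j - z ! j)\<bar> < \<epsilon>"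
        by (simp flip: add_divide_distrib)
      with kabs_le_sum show ?thesis by (rule le_less_trans)
    qed
    then show ?thesis using \<epsilon>(2)[OF lenw] by (simp add: yw)
  qed
  then show "\<exists>\<epsilon>>0. \<forall>y. length y = 2 * n \<and> (\<forall>j<2 * n. \<bar>y ! j - x ! j\<bar> < \<epsilon>) \<longrightarrow> y \<in> to_reals ` V"
    using \<epsilon>(1) by (intro exI[of _ "\<epsilon> / 2"]) auto
qed

text \<open>\<open>to_reals\<close> puts the imaginary part of the value last, so forgetting it is a
  single projection of the graph of \<open>f\<close>.\<close>

lemma definable_fun_re:
  assumes len: "V \<subseteq> {z. length z = n}" and "K_definable_fun M n V f"
  shows "definable_fun M (2 * n) (to_reals ` V) (\<lambda>x. re (f (of_reals x)))"
proof -
  define G where "G = to_reals ` (\<lambda>z. z @ [f z]) ` V"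
  have "definable M (Suc (2 * n + 1)) G"
    using assms(2) by (simp add: G_def K_definable_fun_def K_definable_def)
  then have "definable M (2 * n + 1) {xs. length xs = 2 * n + 1 \<and> (\<exists>a. xs @ [a] \<in> G)}"
    by (rule definable_project)
  moreover have "{xs. length xs = 2 * n + 1 \<and> (\<exists>a. xs @ [a] \<in> G)}
    = (\<lambda>x. x @ [re (f (of_reals x))]) ` to_reals ` V" (is "?P = ?Q")
  proof
    show "?P \<subseteq> ?Q"
    proof clarify
      fix xs a
      assume "xs @ [a] \<in> G"
      then obtain z where z: "z \<in> V" "xs @ [a] = to_reals z @ [re (f z), im (f z)]"
        by (auto simp: G_def to_reals_append)
      then have "xs = to_reals z @ [re (f z)]"
        by (metis append_butlast_last_id butlast_snoc butlast_append butlast.simps(2) list.distinct(1))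
      then show "xs \<in> ?Q" using z(1) by force
    qed
    show "?Q \<subseteq> ?P"
    proof clarify
      fix z
      assume z: "z \<in> V"
      then have "to_reals z @ [re (f z), im (f z)] \<in> G"
        unfolding G_def to_reals_in_graph by simp
      then show "length (to_reals z @ [re (f (of_reals (to_reals z)))]) = 2 * n + 1
          \<and> (\<exists>a. (to_reals z @ [re (f (of_reals (to_reals z)))]) @ [a] \<in> G)"
        using z len by auto
    qed
  qed
  ultimately show ?thesis
    by (simp add: definable_fun_def)
qed

lemma re_in_C_omega:
  assumes V: "K_open n V" "K_definable M n V"
    and f: "K_definable_fun M n V f" "K_differentiable_on n V f"
  shows "(\<lambda>x. re (f (of_reals x))) \<in> C_omega M (2 * n) (to_reals ` V)"
proof -
  have len: "V \<subseteq> {z. length z = n}" using V(1) by (simp add: K_open_def)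
  have "K_open (2 * n) (complexify_dom n V)"
    unfolding complexify_dom_eq by (intro K_open_Int K_open_cnj K_open_pair V(1))
  then have "R_analytic_on M (2 * n) (to_reals ` V) (\<lambda>x. re (f (of_reals x)))"
    unfolding R_analytic_on_def
    using R_open_to_reals[OF V(1)] K_definable_complexify_dom[OF V(2)] map_of_R_in_complexify_dom[OF len]
      K_definable_complexify_re[OF f(1)] K_differentiable_on_complexify_re[OF f(2)]
    by (intro ballI exI[of _ "to_reals ` V"] exI[of _ "complexify_dom n V"] exI[of _ "complexify_re f"])
      (auto simp: complexify_re_of_R)
  then show ?thesis
    using R_open_to_reals[OF V(1)] definable_fun_re[OF len f(1)] by (simp add: C_omega_def)
qed

text \<open>The value \<open>w\<close> is taken exactly when \<open>f z = i_K * w\<close>, that is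
  \<open>Cpx (- im w) (re w)\<close>. The new graph is thus the preimage of the old one under a swap
  of the last two coordinates with one sign change.\<close>

lemma K_definable_fun_mult_minus_i:
  fixes M :: "('f, 'p, 'a::linordered_field) expansion"
  assumes "V \<subseteq> {z. length z = n}" "K_definable_fun M n V f"
  shows "K_definable_fun M n V (\<lambda>z. - i_K * f z)"
proof -
  define G where "G = to_reals ` (\<lambda>z. z @ [f z]) ` V"
  define m where "m = 2 * (n + 1)"
  define ts :: "'f fo_term list" where
    "ts = map Var [0..<2 * n] @ [Uminus (Var (Suc (2 * n))), Var (2 * n)]"
  have "definable M m G"
    using assms by (simp add: G_def m_def K_definable_fun_def K_definable_def)
  then have "definable M m {xs. length xs = m \<and> map (term_val M ((!) xs)) ts \<in> G}"
    by (rule definable_preimage) (auto simp: ts_def m_def)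
  moreover have "{xs. length xs = m \<and> map (term_val M ((!) xs)) ts \<in> G}
    = to_reals ` (\<lambda>z. z @ [- i_K * f z]) ` V" (is "?P = ?Q")
  proof (rule set_eqI)
    fix xs
    show "xs \<in> ?P \<longleftrightarrow> xs \<in> ?Q"
    proof (cases "length xs = m")
      case True
      define z where "z = butlast (of_reals xs)"
      define w where "w = last (of_reals xs)"
      have xs: "xs = to_reals (of_reals xs)"
        using True by (simp add: to_reals_of_reals m_def)
      then have len: "length (of_reals xs) = n + 1"
        using True length_to_reals[of "of_reals xs"] by (simp add: m_def)
      then have "of_reals xs = z @ [w]"
        by (metis z_def w_def append_butlast_last_id Suc_eq_plus1 list.size(3) nat.distinct(1))
      then have xs_eq: "xs = to_reals z @ [re w, im w]" and z: "length z = n"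
        using xs len by (simp_all add: to_reals_append)
      have "map (term_val M ((!) xs)) ts = to_reals z @ [- im w, re w]"
        using z by (auto simp: ts_def xs_eq nth_append intro!: nth_equalityI)
      then have "xs \<in> ?P \<longleftrightarrow> z \<in> V \<and> f z = Cpx (- im w) (re w)"
        using True by (simp add: G_def to_reals_in_graph)
      also have "\<dots> \<longleftrightarrow> z \<in> V \<and> - i_K * f z = w"
        by (auto simp: i_K_def cpx_defs)
      also have "\<dots> \<longleftrightarrow> xs \<in> ?Q"
        unfolding xs_eq to_reals_in_graph by simp
      finally show ?thesis .
    next
      case False
      then show ?thesis using assms(1) by (auto simp: m_def)
    qed
  qed
  ultimately show ?thesis
    by (simp add: K_definable_fun_def K_definable_def m_def)
qed

theorem theorem1p7:
  fixes M :: "('f, 'p, 'a::real_closed_field) expansion"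
    and n :: nat
    and V :: "'a cpx list set"
    and f :: "'a cpx list \<Rightarrow> 'a cpx"
  assumes "o_minimal M"
    and "K_open n V"
    and "K_definable M n V"
    and "K_definable_fun M n V f"
    and "K_differentiable_on n V f"
  shows "(\<lambda>x. re (f (of_reals x))) \<in> C_omega M (2 * n) (to_reals ` V) \<and>
         (\<lambda>x. im (f (of_reals x))) \<in> C_omega M (2 * n) (to_reals ` V)"
proof
  show "(\<lambda>x. re (f (of_reals x))) \<in> C_omega M (2 * n) (to_reals ` V)"
    using assms by (intro re_in_C_omega)
  have "V \<subseteq> {z. length z = n}" using assms(2) by (simp add: K_open_def)
  then have "(\<lambda>x. re (- i_K * f (of_reals x))) \<in> C_omega M (2 * n) (to_reals ` V)"
    using assms by (intro re_in_C_omega K_definable_fun_mult_minus_i K_differentiable_on_cmult)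
  moreover have "re (- i_K * w) = im w" for w :: "'a cpx"
    by (simp add: i_K_def cpx_defs)
  ultimately show "(\<lambda>x. im (f (of_reals x))) \<in> C_omega M (2 * n) (to_reals ` V)"
    by simp
qed

end
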